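(* Consider a CAV (vehicle $1$) and one trailing HDV (vehicle $2$), with $v_1(t^c)=v_2(t^c)=v_{\max}$ and $\delta_2(t^c)>0$. Let $t^p=t^c+\tau^t+\tau^s$ be the desired platoon formation time, where $\tau^t>0$ is the platoon transition duration and $\tau^s$ is the given platoon stabilization duration, and put $t^s=t^c+\tau^t$. Then there exists an unconstrained control input parameter $u_p$ such that, with the CAV control input $u_1(t)=u_p$ for $t\in[t^c,t^s]$ and $u_1(t)=0$ for $t\in(t^s,t^f]$, a vehicle platoon can be formed with HDV $2$ at time $t=t^p$, according to the condition $$2\,\delta_2(t^c)+u_p\,(\tau^t)^2=0 .$$
   Context: Vehicles $1$ (a connected and automated vehicle, CAV) and $2$ (a human-driven vehicle, HDV, directly behind vehicle $1$) travel on a single lane with $\dot p_i=v_i$, $\dot v_i=u_i$, where $p_i$ is the front-bumper position, $v_i$ the speed and $u_i$ the acceleration of vehicle $i$. The CAV enters the control zone at time $t^c$ and exits it at time $t^f$; its control input is free on $[t^c,t^f]$. All vehicles have length $l_c$; $v_{\max}>0$ is the maximum allowable speed. Dynamic following spacing: $s_2(t)=\rho_2 v_2(t)+s_0$, with $\rho_2$ the desired time gap and $s_0$ the standstill distance. Platoon gap: $\delta_2(t)=p_1(t)-p_2(t)-s_2(t)-l_c$. HDV behaviour (modelling convention): while $\delta_2(t)>0$ the HDV is in decoupled free-flow mode; having entered the control zone phase at speed $v_{\max}$, it keeps $v_2(t)=v_{\max}$ as long as it is in this mode. When $\delta_2(t)\le 0$ it is in coupled following mode and $v_2$ converges to $v_1$.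 Platoon formation at time $t^p$ means: there are a speed $v_{eq}$ and a constant $c_2\le 0$ with $v_1(t)=v_2(t)=v_{eq}$ and $\delta_2(t)=c_2$ for all $t\ge t^p$. It takes place in two sequential steps. (i) Platoon transition: the HDV passes from decoupled free-flow mode to coupled following mode at time $t^s$, $t^c<t^s<t^p$, where $\delta_2(t^s)=0$; the duration is $\tau^t=t^s-t^c$. (ii) Platoon stabilization: $v_2$ converges to $v_1$ and the platoon becomes stable at time $t^p$; the duration is $\tau^s=t^p-t^s$, which is treated as a known quantity given a priori (it is the sum of a driver response time and an upper bound on the driver's perception delay). Thus, once the transition step is completed at $t^s$, the platoon is regarded as formed at $t^s+\tau^s$. "Unconstrained" means that the bounds on speed and acceleration and the requirement that the platoon be formed before the end of the control zone are not imposed. *)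

theory Defs
  imports "HOL-Analysis.Analysis"
begin

record vehicle =
  pos :: "real \<Rightarrow> real"
  speed :: "real \<Rightarrow> real"
  accel :: "real \<Rightarrow> real"

text \<open>
  The acceleration may jump (the CAV input is piecewise constant), so the equation for the
  speed is required only outside a set of times that is finite on bounded intervals; continuity
  of the speed makes the acceleration determine it nevertheless.
\<close>

definition longitudinal_dynamics :: "real \<Rightarrow> vehicle \<Rightarrow> bool" where
  "longitudinal_dynamics tc X \<longleftrightarrow>
     (\<forall>t\<ge>tc. (pos X has_real_derivative speed X t) (at t within {tc..})) \<and>
     continuous_on {tc..} (speed X) \<and>
     (\<exists>S. (\<forall>T. finite (S \<inter> {tc..T})) \<and>
        (\<forall>t\<in>{tc..} - S. (speed X has_real_derivative accel X t) (at t within {tc..})))"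

definition following_spacing :: "real \<Rightarrow> real \<Rightarrow> real \<Rightarrow> real" where
  "following_spacing \<rho> s0 v = \<rho> * v + s0"

definition platoon_gap :: "real \<Rightarrow> real \<Rightarrow> real \<Rightarrow> real \<Rightarrow> real \<Rightarrow> real \<Rightarrow> real" where
  "platoon_gap \<rho> s0 lc p1 p2 v2 = p1 - p2 - following_spacing \<rho> s0 v2 - lc"

definition gap_at :: "real \<Rightarrow> real \<Rightarrow> real \<Rightarrow> vehicle \<Rightarrow> vehicle \<Rightarrow> real \<Rightarrow> real" where
  "gap_at \<rho> s0 lc C H t = platoon_gap \<rho> s0 lc (pos C t) (pos H t) (speed H t)"

text \<open>
  The argument \<open>\<delta>\<close> below is the platoon gap as a function of time: the follower is decoupled
  while it is positive and coupled when it is nonpositive.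
\<close>

definition transition_at :: "real \<Rightarrow> (real \<Rightarrow> real) \<Rightarrow> real \<Rightarrow> bool" where
  "transition_at tc \<delta> ts \<longleftrightarrow> tc < ts \<and> (\<forall>t\<in>{tc..<ts}. 0 < \<delta> t) \<and> \<delta> ts = 0"

text \<open>
  Driver model: free flow at \<open>vmax\<close> in decoupled mode; after a transition to coupled mode the
  follower's speed has converged to the leader's once the given stabilization time \<open>\<tau>s\<close> has
  elapsed. That the speeds are then constant and the gap is a nonpositive constant is not part
  of the model.
\<close>

definition hdv_behaviour ::
  "real \<Rightarrow> real \<Rightarrow> real \<Rightarrow> (real \<Rightarrow> real) \<Rightarrow> vehicle \<Rightarrow> vehicle \<Rightarrow> bool" where
  "hdv_behaviour tc vmax \<tau>s \<delta> C H \<longleftrightarrow>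
     (\<forall>t\<ge>tc. 0 < \<delta> t \<longrightarrow> speed H t = vmax) \<and>
     (\<forall>s. transition_at tc \<delta> s \<longrightarrow> (\<forall>t\<ge>s + \<tau>s. speed H t = speed C t))"

text \<open>
  Platoon formation speaks about all later times, whereas the input is prescribed only up to the
  exit time \<open>tf\<close>; the last conjunct fixes the convention that the leader keeps cruising
  afterwards. Nothing is assumed about the order of \<open>tf\<close> and \<open>ts\<close>.
\<close>

definition cav_input :: "real \<Rightarrow> real \<Rightarrow> real \<Rightarrow> real \<Rightarrow> (real \<Rightarrow> real) \<Rightarrow> bool" where
  "cav_input tc ts tf up u \<longleftrightarrow>
     (\<forall>t\<in>{tc..ts}. u t = up) \<and>
     (\<forall>t\<in>{ts<..tf}. u t = 0) \<and>
     (\<forall>t>max ts tf. u t = 0)"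

definition platoon_formed_at :: "(real \<Rightarrow> real) \<Rightarrow> vehicle \<Rightarrow> vehicle \<Rightarrow> real \<Rightarrow> bool" where
  "platoon_formed_at \<delta> C H tp \<longleftrightarrow>
     (\<exists>veq c2. c2 \<le> 0 \<and> (\<forall>t\<ge>tp. speed C t = veq \<and> speed H t = veq \<and> \<delta> t = c2))"

text \<open>
  \<open>mixed_motion\<close>: leader \<open>C\<close> and follower \<open>H\<close>, at \<open>x1\<close> and \<open>x2\<close> with common speed \<open>vmax\<close> at
  time \<open>tc\<close>, move under the dynamics, the leader's input with parameter \<open>up\<close>, and the driver
  model. No bounds on speeds or accelerations are imposed.
\<close>

definition mixed_motion ::
  "real \<Rightarrow> real \<Rightarrow> real \<Rightarrow> real \<Rightarrow> real \<Rightarrow> real \<Rightarrow> real \<Rightarrow> real \<Rightarrow> real \<Rightarrow> real \<Rightarrow> real \<Rightarrow>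
     vehicle \<Rightarrow> vehicle \<Rightarrow> bool" where
  "mixed_motion \<rho> s0 lc vmax \<tau>s tc ts tf x1 x2 up C H \<longleftrightarrow>
     longitudinal_dynamics tc C \<and> longitudinal_dynamics tc H \<and>
     pos C tc = x1 \<and> pos H tc = x2 \<and> speed C tc = vmax \<and> speed H tc = vmax \<and>
     cav_input tc ts tf up (accel C) \<and>
     hdv_behaviour tc vmax \<tau>s (gap_at \<rho> s0 lc C H) C H"

end

theory Submission
  imports Defs
begin

text \<open>
  Let \<open>D > 0\<close> be the initial gap. As long as the gap is positive the follower cruises at \<open>vmax\<close>,
  so its spacing is constant, and the gap changes only through the leader's acceleration: it equals
  \<open>D + up (t - tc)\<^sup>2 / 2\<close>. With \<open>2 D + up \<tau>t\<^sup>2 = 0\<close> this is positive before \<open>ts\<close> and zero at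
  \<open>ts\<close>. The free-flow rule is itself conditional on a positive gap, so this reasoning is not yet
  complete; it is closed by looking at the first time at which the gap is nonpositive, up to which
  the formula is valid (lemma \<open>transition_of_motion\<close>).

  After \<open>ts\<close> the leader cruises at \<open>vmax + up \<tau>t\<close>, which is less than \<open>vmax\<close>, and from \<open>tp\<close> on
  the follower has the same speed, so the gap is constant. It cannot be positive, because then the
  follower would be in free flow at \<open>vmax\<close>, faster than the leader
  (lemma \<open>platoon_of_motion\<close>).

  It remains to show that such motions exist. The leader is determined. The follower has to shed
  the excess speed \<open>W = - up \<tau>t\<close> during the stabilization period without the gap becoming
  positive. For \<open>\<rho> > 0\<close>, braking reduces the desired spacing \<open>\<rho> v + s0\<close> and hence opens the gap; when the time
  gap \<open>\<rho>\<close> is long compared with \<open>\<tau>s\<close>, plain braking would make it positive. The follower therefore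
  first closes up: with \<open>x = (t - ts) / \<tau>s\<close> its excess speed is \<open>W (1 - x) (1 + k x)\<close>, where
  \<open>k\<close> grows with \<open>\<rho> / \<tau>s\<close>, so that the distance gained outweighs the loss of spacing
  (lemmas \<open>closing_up_outweighs_braking\<close> and \<open>motion_exists\<close>).
\<close>

section \<open>Motion with piecewise constant acceleration\<close>

lemma affine_if_constant_derivative:
  fixes f :: "real \<Rightarrow> real"
  assumes "finite K" and "continuous_on {a..b} f"
    and "\<And>t. t \<in> {a..b} - K \<Longrightarrow> (f has_real_derivative c) (at t within {a..b})"
    and "t \<in> {a..b}"
  shows "f t = f a + c * (t - a)"
proof -
  have "f t - c * (t - a) = f a"
  proof (rule has_derivative_zero_unique_strong_interval[where f = "\<lambda>t. f t - c * (t - a)"])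
    show "continuous_on {a..b} (\<lambda>t. f t - c * (t - a))"
      using assms(2) by (intro continuous_intros)
    show "((\<lambda>t. f t - c * (t - a)) has_derivative (\<lambda>h. 0)) (at x within {a..b})"
      if "x \<in> {a..b} - K" for x
    proof -
      have "((\<lambda>t. f t - c * (t - a)) has_real_derivative c - c) (at x within {a..b})"
        using assms(3)[OF that] by (auto intro!: derivative_eq_intros)
      then show ?thesis
        by (simp only: has_field_derivative_def diff_self flip: lambda_zero)
    qed
  qed (use assms in auto)
  then show ?thesis by simp
qed

lemma pos_derivative:
  assumes "longitudinal_dynamics tc X" and "tc \<le> a" and "t \<in> {a..b}"
  shows "(pos X has_real_derivative speed X t) (at t within {a..b})"
proof (rule DERIV_subset)
  show "(pos X has_real_derivative speed X t) (at t within {tc..})"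
    using assms unfolding longitudinal_dynamics_def by auto
qed (use assms in auto)

lemma pos_continuous:
  assumes "longitudinal_dynamics tc X" and "tc \<le> a"
  shows "continuous_on {a..b} (pos X)"
  using pos_derivative[OF assms] by (rule DERIV_continuous_on)

lemma speed_continuous:
  assumes "longitudinal_dynamics tc X" and "tc \<le> a"
  shows "continuous_on {a..b} (speed X)"
  using assms unfolding longitudinal_dynamics_def
  by (auto elim: continuous_on_subset)

lemma speed_of_constant_accel:
  assumes dyn: "longitudinal_dynamics tc X" and "tc \<le> a"
    and accel: "\<And>t. t \<in> {a<..b} \<Longrightarrow> accel X t = c"
    and "t \<in> {a..b}"
  shows "speed X t = speed X a + c * (t - a)"
proof -
  obtain S where S: "\<And>T. finite (S \<inter> {tc..T})"
    and der: "\<And>t. t \<in> {tc..} - S \<Longrightarrow>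
      (speed X has_real_derivative accel X t) (at t within {tc..})"
    using dyn unfolding longitudinal_dynamics_def by blast
  show ?thesis
  proof (rule affine_if_constant_derivative[where K = "insert a (S \<inter> {tc..b})"])
    show "(speed X has_real_derivative c) (at x within {a..b})"
      if x: "x \<in> {a..b} - insert a (S \<inter> {tc..b})" for x
    proof (rule DERIV_subset)
      show "(speed X has_real_derivative c) (at x within {tc..})"
        using der[of x] accel[of x] x \<open>tc \<le> a\<close> by auto
    qed (use \<open>tc \<le> a\<close> in auto)
  qed (use S speed_continuous[OF dyn \<open>tc \<le> a\<close>] \<open>t \<in> {a..b}\<close> in auto)
qed

lemma pos_of_affine_speed:
  assumes dyn: "longitudinal_dynamics tc X" and "tc \<le> a"
    and speed: "\<And>t. t \<in> {a..<b} \<Longrightarrow> speed X t = v + c * (t - a)"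
    and "t \<in> {a..b}"
  shows "pos X t = pos X a + v * (t - a) + c * (t - a)\<^sup>2 / 2"
proof -
  have "pos X t - c * (t - a)\<^sup>2 / 2 = pos X a - c * (a - a)\<^sup>2 / 2 + v * (t - a)"
  proof (rule affine_if_constant_derivative[where K = "{b}"])
    show "continuous_on {a..b} (\<lambda>t. pos X t - c * (t - a)\<^sup>2 / 2)"
      using pos_continuous[OF dyn \<open>tc \<le> a\<close>] by (intro continuous_intros) auto
    show "((\<lambda>t. pos X t - c * (t - a)\<^sup>2 / 2) has_real_derivative v) (at x within {a..b})"
      if "x \<in> {a..b} - {b}" for x
      using pos_derivative[OF dyn \<open>tc \<le> a\<close>, of x b] speed[of x] that
      by (auto intro!: derivative_eq_intros)
  qed (use \<open>t \<in> {a..b}\<close> in auto)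
  then show ?thesis by simp
qed

section \<open>Every motion forms a platoon\<close>

lemma cav_input_after:
  assumes "cav_input tc ts tf up u" and "ts < t"
  shows "u t = 0"
  using assms unfolding cav_input_def by (cases "t \<le> tf") auto

lemma gap_in_free_flow:
  assumes motion: "mixed_motion \<rho> s0 lc vmax \<tau>s tc ts tf x1 x2 up C H"
    and free: "\<And>t. t \<in> {tc..<s} \<Longrightarrow> 0 < gap_at \<rho> s0 lc C H t"
    and "tc < s" and "s \<le> ts"
  shows "gap_at \<rho> s0 lc C H s = platoon_gap \<rho> s0 lc x1 x2 vmax + up * (s - tc)\<^sup>2 / 2"
proof -
  have dynC: "longitudinal_dynamics tc C" and dynH: "longitudinal_dynamics tc H"
    and init: "pos C tc = x1" "pos H tc = x2" "speed C tc = vmax"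
    and input: "cav_input tc ts tf up (accel C)"
    and driver: "hdv_behaviour tc vmax \<tau>s (gap_at \<rho> s0 lc C H) C H"
    using motion unfolding mixed_motion_def by auto
  have speedC: "speed C t = vmax + up * (t - tc)" if "t \<in> {tc..s}" for t
    using speed_of_constant_accel[OF dynC order_refl _ that, of up] input init \<open>s \<le> ts\<close>
    unfolding cav_input_def by auto
  have posC: "pos C s = x1 + vmax * (s - tc) + up * (s - tc)\<^sup>2 / 2"
    using pos_of_affine_speed[OF dynC order_refl, of s vmax up s] speedC init \<open>tc < s\<close> by auto
  have speedH: "speed H t = vmax" if "t \<in> {tc..<s}" for t
    using driver free[OF that] that unfolding hdv_behaviour_def by auto
  have posH: "pos H s = x2 + vmax * (s - tc)"
    using pos_of_affine_speed[OF dynH order_refl, of s vmax 0 s] speedH init \<open>tc < s\<close> by auto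
  have clos: "closure {tc..<s} = {tc..s}"
    using \<open>tc < s\<close> by (rule closure_atLeastLessThan)
  have "speed H s = vmax"
    by (rule continuous_constant_on_closure[where S = "{tc..<s}"])
      (use clos speedH speed_continuous[OF dynH order_refl] \<open>tc < s\<close> in auto)
  then show ?thesis
    using posC posH by (simp add: gap_at_def platoon_gap_def)
qed

text \<open>
  The gap formula presupposes free flow, which presupposes a positive gap. At the first time with a
  nonpositive gap the formula still holds, so that time cannot lie before \<open>ts\<close>.
\<close>

lemma transition_of_motion:
  assumes motion: "mixed_motion \<rho> s0 lc vmax \<tau>s tc ts tf x1 x2 up C H"
    and cond: "2 * platoon_gap \<rho> s0 lc x1 x2 vmax + up * (ts - tc)\<^sup>2 = 0"
    and gap: "0 < platoon_gap \<rho> s0 lc x1 x2 vmax" and "tc < ts"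
  shows "transition_at tc (gap_at \<rho> s0 lc C H) ts"
proof -
  define \<delta> where "\<delta> = gap_at \<rho> s0 lc C H"
  have dynC: "longitudinal_dynamics tc C" and dynH: "longitudinal_dynamics tc H"
    and init: "\<delta> tc = platoon_gap \<rho> s0 lc x1 x2 vmax"
    using motion unfolding mixed_motion_def \<delta>_def gap_at_def by auto
  have cont: "continuous_on {tc..T} \<delta>" for T
    unfolding \<delta>_def gap_at_def platoon_gap_def following_spacing_def
    using pos_continuous[OF dynC order_refl] pos_continuous[OF dynH order_refl]
      speed_continuous[OF dynH order_refl]
    by (intro continuous_intros)
  have "up * (ts - tc)\<^sup>2 < 0"
    using cond gap by linarith
  then have "up < 0"
    by (auto simp: mult_less_0_iff)
  have pos: "0 < \<delta> t" if t: "t \<in> {tc..<ts}" for t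
  proof (rule ccontr)
    assume "\<not> 0 < \<delta> t"
    define Z where "Z = {tc..t} \<inter> \<delta> -` {..0}"
    have "closed Z"
      unfolding Z_def using cont by (rule continuous_closed_preimage) auto
    then have "compact Z"
      unfolding compact_eq_bounded_closed Z_def
      by (auto intro: bounded_subset[of "{tc..t}"])
    moreover have "Z \<noteq> {}"
      using \<open>\<not> 0 < \<delta> t\<close> t unfolding Z_def by auto
    ultimately obtain s where s: "s \<in> Z" and first: "\<And>r. r \<in> Z \<Longrightarrow> s \<le> r"
      using compact_attains_inf[of Z] by blast
    have free: "0 < \<delta> r" if "r \<in> {tc..<s}" for r
      using first[of r] that s unfolding Z_def by force
    have "tc < s" "s < ts" "\<delta> s \<le> 0"
      using s t init gap unfolding Z_def by (auto simp: order.order_iff_strict)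
    have "(s - tc)\<^sup>2 < (ts - tc)\<^sup>2"
      using \<open>tc < s\<close> \<open>s < ts\<close> by (intro power_strict_mono) auto
    then have "up * (ts - tc)\<^sup>2 < up * (s - tc)\<^sup>2"
      using \<open>up < 0\<close> by simp
    moreover have "\<delta> s = platoon_gap \<rho> s0 lc x1 x2 vmax + up * (s - tc)\<^sup>2 / 2"
      using gap_in_free_flow[OF motion, of s] free \<open>tc < s\<close> \<open>s < ts\<close> unfolding \<delta>_def by auto
    ultimately show False
      using cond \<open>\<delta> s \<le> 0\<close> by linarith
  qed
  moreover have "\<delta> ts = 0"
    using gap_in_free_flow[OF motion, of ts] pos cond \<open>tc < ts\<close> unfolding \<delta>_def by auto
  ultimately show ?thesis
    using \<open>tc < ts\<close> unfolding transition_at_def \<delta>_def by auto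
qed

lemma platoon_of_motion:
  assumes motion: "mixed_motion \<rho> s0 lc vmax \<tau>s tc ts tf x1 x2 up C H"
    and trans: "transition_at tc (gap_at \<rho> s0 lc C H) ts"
    and "up < 0" and "0 \<le> \<tau>s"
  shows "platoon_formed_at (gap_at \<rho> s0 lc C H) C H (ts + \<tau>s)"
proof -
  define \<delta> where "\<delta> = gap_at \<rho> s0 lc C H"
  define tp where "tp = ts + \<tau>s"
  define veq where "veq = vmax + up * (ts - tc)"
  have dynC: "longitudinal_dynamics tc C" and dynH: "longitudinal_dynamics tc H"
    and init: "speed C tc = vmax"
    and input: "cav_input tc ts tf up (accel C)"
    and driver: "hdv_behaviour tc vmax \<tau>s \<delta> C H"
    using motion unfolding mixed_motion_def \<delta>_def by auto
  have "tc < ts"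
    using trans unfolding transition_at_def by simp
  have "speed C ts = veq"
    using speed_of_constant_accel[OF dynC order_refl, of ts up ts] input init \<open>tc < ts\<close>
    unfolding cav_input_def veq_def by auto
  then have speedC: "speed C t = veq" if "ts \<le> t" for t
    using speed_of_constant_accel[OF dynC, of ts t 0 t] cav_input_after[OF input] \<open>tc < ts\<close> that
    by auto
  have speedH: "speed H t = veq" if "tp \<le> t" for t
    using driver trans speedC[of t] that \<open>0 \<le> \<tau>s\<close>
    unfolding hdv_behaviour_def \<delta>_def tp_def by auto
  have "tc \<le> tp" "ts \<le> tp"
    using \<open>tc < ts\<close> \<open>0 \<le> \<tau>s\<close> unfolding tp_def by auto
  have gap_const: "\<delta> t = \<delta> tp" if "tp \<le> t" for t
  proof -
    have "pos C t = pos C tp + veq * (t - tp)"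
      using pos_of_affine_speed[OF dynC \<open>tc \<le> tp\<close>, of t veq 0 t] speedC that \<open>ts \<le> tp\<close> by auto
    moreover have "pos H t = pos H tp + veq * (t - tp)"
      using pos_of_affine_speed[OF dynH \<open>tc \<le> tp\<close>, of t veq 0 t] speedH that by auto
    ultimately show ?thesis
      using speedH that by (simp add: \<delta>_def gap_at_def platoon_gap_def)
  qed
  have "\<delta> tp \<le> 0"
  proof (rule ccontr)
    assume "\<not> \<delta> tp \<le> 0"
    then have "speed H tp = vmax"
      using driver \<open>tc \<le> tp\<close> unfolding hdv_behaviour_def by auto
    then have "up * (ts - tc) = 0"
      using speedH[of tp] unfolding veq_def by simp
    then show False
      using \<open>up < 0\<close> \<open>tc < ts\<close> by simp
  qed
  moreover have "speed C t = veq \<and> speed H t = veq \<and> \<delta> t = \<delta> tp" if "tp \<le> t" for t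
    using speedC[of t] speedH[of t] gap_const[of t] that \<open>ts \<le> tp\<close> by (intro conjI) linarith+
  ultimately show ?thesis
    unfolding platoon_formed_at_def \<delta>_def[symmetric] tp_def[symmetric] by blast
qed

section \<open>A motion exists\<close>

text \<open>
  The trajectories below are cubic splines in \<open>t\<close> with knots at \<open>ts\<close> and \<open>tp\<close>. Writing them with
  truncated powers of \<open>t - ts\<close> and \<open>t - tp\<close> avoids gluing separate pieces: only the first power is
  not differentiable at its knot.
\<close>

lemma truncated_linear_derivative:
  fixes a t :: real
  assumes "t \<noteq> a"
  shows "((\<lambda>t. max 0 (t - a)) has_real_derivative (if a < t then 1 else 0)) (at t within A)"
proof -
  have "((\<lambda>t. max 0 (t - a)) has_real_derivative (if a < t then 1 else 0)) (at t)"
  proof (cases "a < t")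
    case True
    have "((\<lambda>t. t - a) has_real_derivative 1) (at t)"
      by (auto intro!: derivative_eq_intros)
    then show ?thesis
      using True by (auto elim!: has_field_derivative_transform_within_open[of _ _ _ "{a<..}"])
  next
    case False
    have "((\<lambda>t. 0) has_real_derivative 0) (at t)"
      by simp
    then have "((\<lambda>t. max 0 (t - a)) has_real_derivative 0) (at t)"
      by (rule has_field_derivative_transform_within_open[where S = "{..<a}"])
        (use False assms in auto)
    then show ?thesis
      using False by simp
  qed
  then show ?thesis
    by (rule has_field_derivative_at_within)
qed

lemma truncated_power_derivative:
  fixes a t :: real
  assumes "2 \<le> n"
  shows "((\<lambda>t. max 0 (t - a) ^ n) has_real_derivative
            real n * max 0 (t - a) ^ (n - 1)) (at t within A)"
proof (cases "t = a")
  case False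
  show ?thesis
    using DERIV_power[OF truncated_linear_derivative[OF False], of n A] \<open>2 \<le> n\<close>
    by (cases "a < t") (auto simp: max_absorb1 power_0_left)
next
  case True
  obtain m where n: "n = Suc (Suc m)"
    using \<open>2 \<le> n\<close> by (metis add_2_eq_Suc le_Suc_ex)
  have "((\<lambda>h. max 0 (a + h - a) ^ n / h) \<longlongrightarrow> 0) (at 0)"
  proof (rule Lim_null_comparison)
    show "\<forall>\<^sub>F h in at (0::real). norm (max 0 (a + h - a) ^ n / h) \<le> \<bar>h\<bar> ^ Suc m"
    proof (rule always_eventually, rule allI)
      show "norm (max 0 (a + h - a) ^ n / h) \<le> \<bar>h\<bar> ^ Suc m" for h :: real
        by (cases "0 < h") (simp_all add: n max_absorb1 max_absorb2 del: power_Suc, simp)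
    qed
    show "((\<lambda>h::real. \<bar>h\<bar> ^ Suc m) \<longlongrightarrow> 0) (at 0)"
      by (auto intro!: tendsto_eq_intros)
  qed
  then have "((\<lambda>t. max 0 (t - a) ^ n) has_real_derivative 0) (at a)"
    by (simp add: n DERIV_def)
  then show ?thesis
    using True by (simp add: n has_field_derivative_at_within)
qed

corollary truncated_square_derivative:
  fixes a t :: real
  shows "((\<lambda>t. (max 0 (t - a))\<^sup>2) has_real_derivative 2 * max 0 (t - a)) (at t within A)"
  using truncated_power_derivative[of 2 a t A] by simp

corollary truncated_cube_derivative:
  fixes a t :: real
  shows "((\<lambda>t. max 0 (t - a) ^ 3) has_real_derivative 3 * (max 0 (t - a))\<^sup>2) (at t within A)"
  using truncated_power_derivative[of 3 a t A] by simp

text \<open>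
  With \<open>r\<close> the time since the transition, and for the excess speed \<open>W (1 - x) (1 + k x)\<close> at
  \<open>x = r / \<tau>s\<close>, the expression is the negative of the gap, divided by the mean deceleration
  \<open>W / \<tau>s\<close>: the first three terms are the distance closed up, the last is the change of spacing.
  The choice of \<open>k\<close> makes the quadratic distance gain \<open>(k - 1) r\<^sup>2 / 6\<close> equal to the worst loss of
  spacing \<open>\<rho> r\<^sup>2 / \<tau>s\<close>; if \<open>\<rho> \<le> 0\<close>, no spacing is lost and \<open>k = 1\<close> suffices.
\<close>

lemma closing_up_outweighs_braking:
  fixes \<rho> \<tau>s r :: real
  assumes "0 < \<tau>s" and r: "0 \<le> r" "r \<le> \<tau>s"
    and k: "k = 1 + 6 * max \<rho> 0 / \<tau>s"
  shows "0 \<le> \<tau>s * r + (k - 1) * r\<^sup>2 / 2 - k / \<tau>s * r ^ 3 / 3 + \<rho> * ((k - 1) * r - k / \<tau>s * r\<^sup>2)"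
proof -
  define x where "x = r / \<tau>s"
  define m where "m = max \<rho> 0"
  have x: "0 \<le> x" "x \<le> 1" and rx: "r = \<tau>s * x"
    using assms by (auto simp: x_def divide_simps)
  have "0 \<le> m" and km: "(k - 1) * \<tau>s = 6 * m"
    using k \<open>0 < \<tau>s\<close> by (auto simp: m_def)
  have "1 \<le> k"
    using k \<open>0 < \<tau>s\<close> by auto
  have cube: "k * x\<^sup>2 \<le> k * x"
    using x \<open>1 \<le> k\<close> by (simp add: power2_eq_square mult_left_le)
  have spacing: "- m * x \<le> \<rho> * (k - 1 - k * x)"
  proof (cases "0 \<le> \<rho>")
    case True
    have "(k - 1) * x \<le> k - 1"
      using x \<open>1 \<le> k\<close> by (simp add: mult_left_le)
    then have "\<rho> * (- x) \<le> \<rho> * (k - 1 - k * x)"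
      using True by (intro mult_left_mono) (auto simp: algebra_simps)
    then show ?thesis
      using True by (simp add: m_def)
  next
    case False
    then have "k = 1" "m = 0"
      using k by (auto simp: m_def)
    then show ?thesis
      using False x by (simp add: mult_nonpos_nonneg)
  qed
  have "\<tau>s * (k * x\<^sup>2) \<le> \<tau>s * (k * x)"
    using cube \<open>0 < \<tau>s\<close> by simp
  also have "\<dots> = (k - 1) * \<tau>s * x + \<tau>s * x"
    by (simp add: algebra_simps)
  finally have "\<tau>s * (k * x\<^sup>2) \<le> (k - 1) * \<tau>s * x + \<tau>s * x" .
  moreover have "(k - 1) * \<tau>s * x = 6 * m * x"
    using km by simp
  moreover have "\<tau>s * x \<le> \<tau>s"
    using x \<open>0 < \<tau>s\<close> by (simp add: mult_left_le)
  ultimately have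
    "0 \<le> \<tau>s + (k - 1) * \<tau>s * x / 2 - \<tau>s * (k * x\<^sup>2) / 3 + \<rho> * (k - 1 - k * x)"
    using spacing \<open>0 < \<tau>s\<close> by linarith
  then have "0 \<le> r *
    (\<tau>s + (k - 1) * \<tau>s * x / 2 - \<tau>s * (k * x\<^sup>2) / 3 + \<rho> * (k - 1 - k * x))"
    using r by simp
  also have "\<dots> = \<tau>s * r + (k - 1) * r\<^sup>2 / 2 - k / \<tau>s * r ^ 3 / 3
      + \<rho> * ((k - 1) * r - k / \<tau>s * r\<^sup>2)"
    using \<open>0 < \<tau>s\<close> unfolding rx by (simp add: field_simps power2_eq_square power3_eq_cube)
  finally show ?thesis .
qed

lemma motion_exists:
  assumes cond: "2 * platoon_gap \<rho> s0 lc x1 x2 vmax + up * (ts - tc)\<^sup>2 = 0"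
    and "tc < ts" and "0 < \<tau>s"
    and gap: "0 < platoon_gap \<rho> s0 lc x1 x2 vmax"
  shows "\<exists>C H. mixed_motion \<rho> s0 lc vmax \<tau>s tc ts tf x1 x2 up C H"
proof -
  have "up * (ts - tc)\<^sup>2 < 0"
    using cond gap by linarith
  then have "up < 0"
    by (auto simp: mult_less_0_iff)
  define tp where "tp = ts + \<tau>s"
  define W where "W = - up * (ts - tc)"
  define k where "k = 1 + 6 * max \<rho> 0 / \<tau>s"
  define a where "a = W / \<tau>s"
  define e where "e = k / \<tau>s"
  define r where "r t = max 0 (t - ts)" for t
  define q where "q t = max 0 (t - tp)" for t
  define C where "C = \<lparr>
    pos = \<lambda>t. x1 + vmax * (t - tc) + up * ((t - tc)\<^sup>2 - (r t)\<^sup>2) / 2,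
    speed = \<lambda>t. vmax + up * ((t - tc) - r t),
    accel = \<lambda>t. up * (1 - (if ts < t then 1 else 0)) \<rparr>"
  \<comment> \<open>Between \<open>ts\<close> and \<open>tp\<close> only \<open>r\<close> contributes and the speed is \<open>vmax - W + W (1 - x) (1 + k x)\<close>;
    the terms in \<open>q\<close> continue it from \<open>tp\<close> on by the constant \<open>vmax - W\<close>.\<close>
  define H where "H = \<lparr>
    pos = \<lambda>t. x2 + vmax * (t - tc) + a * ((k - 1) * (r t)\<^sup>2 / 2 - e * r t ^ 3 / 3
      + (k + 1) * (q t)\<^sup>2 / 2 + e * q t ^ 3 / 3),
    speed = \<lambda>t. vmax + a * ((k - 1) * r t - e * (r t)\<^sup>2 + (k + 1) * q t + e * (q t)\<^sup>2),
    accel = \<lambda>t. a * ((k - 1) * (if ts < t then 1 else 0) - 2 * e * r t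
      + (k + 1) * (if tp < t then 1 else 0) + 2 * e * q t) \<rparr>"
  have e: "e * \<tau>s = k" and a: "a * \<tau>s = W" and "0 \<le> a"
    using \<open>0 < \<tau>s\<close> \<open>up < 0\<close> \<open>tc < ts\<close>
    by (auto simp: e_def a_def W_def mult_nonpos_nonneg divide_nonpos_pos)
  have "ts < tp"
    using \<open>0 < \<tau>s\<close> by (simp add: tp_def)
  note r_der = truncated_linear_derivative[of _ ts, folded r_def]
    and r2_der = truncated_square_derivative[of ts, folded r_def]
    and r3_der = truncated_cube_derivative[of ts, folded r_def]
    and q_der = truncated_linear_derivative[of _ tp, folded q_def]
    and q2_der = truncated_square_derivative[of tp, folded q_def]
    and q3_der = truncated_cube_derivative[of tp, folded q_def]
  have contr: "continuous_on A r" and contq: "continuous_on A q" for A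
    unfolding r_def q_def by (intro continuous_intros)+
  have dynC: "longitudinal_dynamics tc C"
    unfolding longitudinal_dynamics_def
  proof (intro conjI allI impI exI[of _ "{ts}"] ballI)
    show "(pos C has_real_derivative speed C t) (at t within {tc..})" for t
      unfolding C_def vehicle.select_convs
      by (rule DERIV_cong, (rule r2_der r3_der q2_der q3_der DERIV_const DERIV_ident
          DERIV_add DERIV_diff DERIV_cdivide DERIV_cmult DERIV_power)+)
        (simp add: field_simps)
    show "continuous_on {tc..} (speed C)"
      unfolding C_def by (auto intro!: continuous_intros contr)
    show "(speed C has_real_derivative accel C t) (at t within {tc..})"
      if "t \<in> {tc..} - {ts}" for t
      unfolding C_def using that by (auto intro!: derivative_eq_intros r_der)
  qed auto
  have dynH: "longitudinal_dynamics tc H"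
    unfolding longitudinal_dynamics_def
  proof (intro conjI allI impI exI[of _ "{ts, tp}"] ballI)
    show "(pos H has_real_derivative speed H t) (at t within {tc..})" for t
      unfolding H_def vehicle.select_convs
      by (rule DERIV_cong, (rule r2_der r3_der q2_der q3_der DERIV_const DERIV_ident
          DERIV_add DERIV_diff DERIV_cdivide DERIV_cmult DERIV_power)+)
        (simp add: field_simps)
    show "continuous_on {tc..} (speed H)"
      unfolding H_def by (auto intro!: continuous_intros contr contq)
    show "(speed H has_real_derivative accel H t) (at t within {tc..})"
      if "t \<in> {tc..} - {ts, tp}" for t
    proof -
      have knots: "t \<noteq> ts" "t \<noteq> tp"
        using that by auto
      show ?thesis
        unfolding H_def vehicle.select_convs
        by (rule DERIV_cong, (rule r2_der q2_der r_der[OF knots(1)] q_der[OF knots(2)]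
            DERIV_const DERIV_add DERIV_diff DERIV_cmult)+) (simp add: algebra_simps)
    qed
  qed auto
  define D where "D = platoon_gap \<rho> s0 lc x1 x2 vmax"
  define \<delta> where "\<delta> = gap_at \<rho> s0 lc C H"
  have gap_formula: "\<delta> t = D + up * ((t - tc)\<^sup>2 - (r t)\<^sup>2) / 2
      - a * ((k - 1) * (r t)\<^sup>2 / 2 - e * r t ^ 3 / 3 + (k + 1) * (q t)\<^sup>2 / 2 + e * q t ^ 3 / 3)
      - \<rho> * (a * ((k - 1) * r t - e * (r t)\<^sup>2 + (k + 1) * q t + e * (q t)\<^sup>2))" for t
    unfolding \<delta>_def D_def gap_at_def platoon_gap_def following_spacing_def C_def H_def
    by (simp add: algebra_simps)
  have before: "\<delta> t = D + up * (t - tc)\<^sup>2 / 2" if "t \<le> ts" for t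
    using that \<open>ts < tp\<close> unfolding gap_formula by (simp add: r_def q_def)
  have pos_before: "0 < \<delta> t" if "tc \<le> t" "t < ts" for t
  proof -
    have "(t - tc)\<^sup>2 < (ts - tc)\<^sup>2"
      using that by (intro power_strict_mono) auto
    then have "up * (ts - tc)\<^sup>2 < up * (t - tc)\<^sup>2"
      using \<open>up < 0\<close> by simp
    then show ?thesis
      using before[of t] that cond unfolding D_def by simp
  qed
  have zero: "\<delta> ts = 0"
    using before[of ts] cond unfolding D_def by simp
  have cruise: "D + up * ((t - tc)\<^sup>2 - (t - ts)\<^sup>2) / 2 = - W * (t - ts)" for t
  proof -
    have "D = - (up * (ts - tc)\<^sup>2) / 2"
      using cond unfolding D_def by simp
    then show ?thesis
      unfolding W_def by (simp add: field_simps power2_eq_square)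
  qed
  have middle: "\<delta> t \<le> 0" if "ts \<le> t" "t \<le> tp" for t
  proof -
    have rt: "r t = t - ts" and qt: "q t = 0"
      using that by (auto simp: r_def q_def)
    have "0 \<le> a * (\<tau>s * r t + (k - 1) * (r t)\<^sup>2 / 2 - k / \<tau>s * r t ^ 3 / 3
        + \<rho> * ((k - 1) * r t - k / \<tau>s * (r t)\<^sup>2))"
      using closing_up_outweighs_braking[OF \<open>0 < \<tau>s\<close> _ _ k_def, of "r t"] that \<open>0 \<le> a\<close>
      by (simp add: rt tp_def)
    also have "\<dots> = - \<delta> t"
      unfolding gap_formula qt rt cruise e_def[symmetric] a[symmetric]
      by (simp add: algebra_simps)
    finally show ?thesis by simp
  qed
  have after: "r t = \<tau>s + q t" if "tp \<le> t" for t
    using that \<open>0 < \<tau>s\<close> by (simp add: r_def q_def tp_def)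
  have speedH: "speed H t = vmax - W" if "tp \<le> t" for t
  proof -
    have "(k - 1) * r t - e * (r t)\<^sup>2 + (k + 1) * q t + e * (q t)\<^sup>2 = - \<tau>s"
      unfolding after[OF that] e[symmetric] by (simp add: algebra_simps power2_eq_square)
    then show ?thesis
      unfolding H_def using a by simp
  qed
  have speedC: "speed C t = vmax - W" if "ts \<le> t" for t
    using that unfolding C_def W_def by (simp add: r_def algebra_simps)
  have late: "\<delta> t \<le> 0" if "tp \<le> t" for t
  proof -
    have "tc \<le> tp"
      using \<open>tc < ts\<close> \<open>ts < tp\<close> by simp
    have "pos C t = pos C tp + (vmax - W) * (t - tp)"
      using pos_of_affine_speed[OF dynC \<open>tc \<le> tp\<close>, of t "vmax - W" 0 t] speedC that \<open>ts < tp\<close>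
      by auto
    moreover have "pos H t = pos H tp + (vmax - W) * (t - tp)"
      using pos_of_affine_speed[OF dynH \<open>tc \<le> tp\<close>, of t "vmax - W" 0 t] speedH that by auto
    ultimately have "\<delta> t = \<delta> tp"
      using speedH that by (simp add: \<delta>_def gap_at_def platoon_gap_def)
    then show ?thesis
      using middle[of tp] \<open>ts < tp\<close> by simp
  qed
  have "hdv_behaviour tc vmax \<tau>s \<delta> C H"
    unfolding hdv_behaviour_def
  proof (intro conjI allI impI)
    fix t assume "tc \<le> t" "0 < \<delta> t"
    then have "t < ts"
      using middle[of t] late[of t] by fastforce
    then show "speed H t = vmax"
      using \<open>ts < tp\<close> unfolding H_def by (simp add: r_def q_def)
  next
    fix s t assume s: "transition_at tc \<delta> s" and t: "s + \<tau>s \<le> t"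
    have "s = ts"
    proof (rule linorder_cases[of s ts])
      assume "s < ts"
      then show ?thesis
        using s pos_before[of s] unfolding transition_at_def by simp
    next
      assume "ts < s"
      then have "0 < \<delta> ts"
        using s \<open>tc < ts\<close> unfolding transition_at_def by auto
      then show ?thesis
        using zero by simp
    qed
    then show "speed H t = speed C t"
      using t speedH[of t] speedC[of t] \<open>ts < tp\<close> unfolding tp_def by simp
  qed
  moreover have "cav_input tc ts tf up (accel C)"
    unfolding cav_input_def C_def by auto
  moreover have "pos C tc = x1" "pos H tc = x2" "speed C tc = vmax" "speed H tc = vmax"
    using \<open>tc < ts\<close> \<open>ts < tp\<close> unfolding C_def H_def by (auto simp: r_def q_def)
  ultimately have "mixed_motion \<rho> s0 lc vmax \<tau>s tc ts tf x1 x2 up C H"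
    using dynC dynH unfolding mixed_motion_def \<delta>_def by simp
  then show ?thesis by blast
qed

theorem theorem1:
  fixes \<rho> s0 lc vmax \<tau>t \<tau>s tc ts tp tf x1 x2 :: real
  assumes "0 < vmax" and "tc < tf"
    and "0 < \<tau>t" and "0 < \<tau>s"
    and "ts = tc + \<tau>t" and "tp = tc + \<tau>t + \<tau>s"
    and "0 < platoon_gap \<rho> s0 lc x1 x2 vmax"
  shows "\<exists>up.
           2 * platoon_gap \<rho> s0 lc x1 x2 vmax + up * \<tau>t\<^sup>2 = 0 \<and>
           (\<exists>C H. mixed_motion \<rho> s0 lc vmax \<tau>s tc ts tf x1 x2 up C H) \<and>
           (\<forall>C H. mixed_motion \<rho> s0 lc vmax \<tau>s tc ts tf x1 x2 up C H \<longrightarrow>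
              transition_at tc (gap_at \<rho> s0 lc C H) ts \<and>
              platoon_formed_at (gap_at \<rho> s0 lc C H) C H tp)"
proof -
  define up where "up = - 2 * platoon_gap \<rho> s0 lc x1 x2 vmax / \<tau>t\<^sup>2"
  have cond: "2 * platoon_gap \<rho> s0 lc x1 x2 vmax + up * \<tau>t\<^sup>2 = 0"
    using assms by (simp add: up_def)
  have "up < 0"
    using assms by (simp add: up_def divide_neg_pos)
  have "tc < ts" and tp: "tp = ts + \<tau>s"
    and cond': "2 * platoon_gap \<rho> s0 lc x1 x2 vmax + up * (ts - tc)\<^sup>2 = 0"
    using assms cond by auto
  have "\<exists>C H. mixed_motion \<rho> s0 lc vmax \<tau>s tc ts tf x1 x2 up C H"
    using motion_exists[OF cond'] \<open>tc < ts\<close> assms by simp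
  moreover have "transition_at tc (gap_at \<rho> s0 lc C H) ts"
    and "platoon_formed_at (gap_at \<rho> s0 lc C H) C H tp"
    if motion: "mixed_motion \<rho> s0 lc vmax \<tau>s tc ts tf x1 x2 up C H" for C H
  proof -
    show trans: "transition_at tc (gap_at \<rho> s0 lc C H) ts"
      using motion cond' assms(7) \<open>tc < ts\<close> by (rule transition_of_motion)
    show "platoon_formed_at (gap_at \<rho> s0 lc C H) C H tp"
      unfolding tp using platoon_of_motion[OF motion trans \<open>up < 0\<close>] assms by simp
  qed
  ultimately show ?thesis
    using cond by blast
qed

end
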